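(* Let $X$ and $Y$ be real Banach spaces, $K\colon X\to Y$ a bounded dilinear mapping with unique bounded linear lifting $\breve K$, and $F\colon Y\to\overline{\mathbb R}$ a convex mapping. Then, for every $u\in X$, $$\breve K^*\,\partial F(K(u))\subset\partial_\beta(F\circ K)(u),$$ where $\partial F$ is the classical convex subdifferential.
   Context: $\overline{\mathbb R}=\mathbb R\cup\{\pm\infty\}$. $X\otimes_{\pi,\mathrm{sym}}X$ is the closed subspace of the (completed) projective tensor product $X\otimes_\pi X$ spanned by the tensors $u\otimes u$, $u\in X$. A mapping $K\colon X\to Y$ is dilinear if there is a linear $\breve K\colon X\times(X\otimes_{\pi,\mathrm{sym}}X)\to Y$ with $K(u)=\breve K(u,u\otimes u)$ for all $u\in X$; it is bounded if $\breve K$ is bounded, and then the bounded $\breve K$ (the lifting) is unique. $\breve K^*\colon Y^*\to X^*\times(X\otimes_{\pi,\mathrm{sym}}X)^*$ is its adjoint. The dilinear subdifferential $\partial_\beta G(u)$ of $G\colon X\to\overline{\mathbb R}$ at $u$ is the set of all $(\xi,\Xi)\in X^*\times(X\otimes_{\pi,\mathrm{sym}}X)^*$ such that $G(u)$ is finite and $G(v)\ge G(u)+\langle\xi,v-u\rangle+\langle\Xi,v\otimes v-u\otimes u\rangle$ for all $v\in X$ (empty if no such element exists). The classical subdifferential $\partial F(y)$ consists of all $\xi\in Y^*$ with $F(y)$ finite and $F(v)\ge F(y)+\langle\xi,v-y\rangle$ for all $v\in Y$. *)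

theory Defs
  imports "HOL-Analysis.Analysis"
begin

section \<open>The algebraic tensor product\<close>

text \<open>A list \<open>[(x1, y1), ..., (xn, yn)]\<close> stands for the formal sum of the \<open>xi \<otimes> yi\<close>.
  Two formal sums are the same tensor iff every (not necessarily bounded) bilinear form
  takes the same value on them, i.e. the algebraic tensor product is realised as the space of
  functionals \<open>B \<mapsto> \<Sum>i. B xi yi\<close> on the bilinear forms.\<close>

definition bilin_sum :: "('a \<Rightarrow> 'b \<Rightarrow> real) \<Rightarrow> ('a \<times> 'b) list \<Rightarrow> real"
  where "bilin_sum B ps = (\<Sum>(x, y)\<leftarrow>ps. B x y)"

definition tensor_eq ::
    "('a::real_vector \<times> 'b::real_vector) list \<Rightarrow> ('a \<times> 'b) list \<Rightarrow> bool"
  where "tensor_eq ps qs \<longleftrightarrow>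
    (\<forall>B :: 'a \<Rightarrow> 'b \<Rightarrow> real. bilinear B \<longrightarrow> bilin_sum B ps = bilin_sum B qs)"

definition scale_left :: "real \<Rightarrow> ('a::real_vector \<times> 'b) list \<Rightarrow> ('a \<times> 'b) list"
  where "scale_left c ps = map (\<lambda>(x, y). (c *\<^sub>R x, y)) ps"

lemma bilin_sum_simps [simp]:
  "bilin_sum B [] = 0"
  "bilin_sum B ((x, y) # ps) = B x y + bilin_sum B ps"
  "bilin_sum B (ps @ qs) = bilin_sum B ps + bilin_sum B qs"
  by (simp_all add: bilin_sum_def)

lemma bilin_sum_scale_left [simp]:
  "bilinear B \<Longrightarrow> bilin_sum B (scale_left c ps) = c * bilin_sum B ps"
  by (induction ps) (auto simp: scale_left_def bilinear_lmul distrib_left)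

quotient_type (overloaded) ('a, 'b) tensor =
    "('a::real_vector \<times> 'b::real_vector) list" / tensor_eq
  by (rule equivpI) (auto simp: reflp_def symp_def transp_def tensor_eq_def)

instantiation tensor :: (real_vector, real_vector) real_vector
begin

lift_definition zero_tensor :: "('a, 'b) tensor" is "[]" .

lift_definition plus_tensor :: "('a, 'b) tensor \<Rightarrow> ('a, 'b) tensor \<Rightarrow> ('a, 'b) tensor"
  is "(@)" by (simp add: tensor_eq_def)

lift_definition scaleR_tensor :: "real \<Rightarrow> ('a, 'b) tensor \<Rightarrow> ('a, 'b) tensor"
  is scale_left by (simp add: tensor_eq_def)

lift_definition uminus_tensor :: "('a, 'b) tensor \<Rightarrow> ('a, 'b) tensor"
  is "scale_left (-1)" by (simp add: tensor_eq_def)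

definition minus_tensor :: "('a, 'b) tensor \<Rightarrow> ('a, 'b) tensor \<Rightarrow> ('a, 'b) tensor"
  where "minus_tensor s t = s + (- t)"

instance
proof
  fix s t u :: "('a, 'b) tensor" and a b :: real
  show "s + t + u = s + (t + u)" "s + t = t + s" "0 + s = s" "- s + s = 0"
    "a *\<^sub>R (s + t) = a *\<^sub>R s + a *\<^sub>R t" "(a + b) *\<^sub>R s = a *\<^sub>R s + b *\<^sub>R s"
    "a *\<^sub>R b *\<^sub>R s = (a * b) *\<^sub>R s" "1 *\<^sub>R s = s"
    by (transfer; simp add: tensor_eq_def algebra_simps)+
  show "s - t = s + - t"
    by (simp add: minus_tensor_def)
qed

end

lifting_forget tensor.lifting

section \<open>The projective norm\<close>

definition pi_cost :: "('a::real_normed_vector \<times> 'b::real_normed_vector) list \<Rightarrow> real"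
  where "pi_cost ps = (\<Sum>(x, y)\<leftarrow>ps. norm x * norm y)"

definition pi_norm :: "('a::real_normed_vector, 'b::real_normed_vector) tensor \<Rightarrow> real"
  where "pi_norm t = (INF ps\<in>{ps. abs_tensor ps = t}. pi_cost ps)"

lemma pi_cost_simps [simp]:
  "pi_cost [] = 0"
  "pi_cost ((x, y) # ps) = norm x * norm y + pi_cost ps"
  "pi_cost (ps @ qs) = pi_cost ps + pi_cost qs"
  by (simp_all add: pi_cost_def)

lemma pi_cost_scale_left [simp]: "pi_cost (scale_left c ps) = \<bar>c\<bar> * pi_cost ps"
  by (induction ps) (auto simp: scale_left_def distrib_left)

lemma pi_cost_nonneg: "0 \<le> pi_cost ps"
  by (induction ps) auto

lemma pi_norm_le: "pi_norm (abs_tensor ps) \<le> pi_cost ps"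
  unfolding pi_norm_def by (rule cINF_lower) (auto intro!: bdd_belowI2 pi_cost_nonneg)

lemma ex_abs_tensor: "\<exists>ps. abs_tensor ps = t"
  by (meson Quotient_abs_rep Quotient_tensor)

lemma pi_norm_nonneg: "0 \<le> pi_norm t"
  unfolding pi_norm_def using ex_abs_tensor[of t] by (intro cINF_greatest) (auto simp: pi_cost_nonneg)

lemma pi_norm_approx:
  assumes "e > 0" obtains ps where "abs_tensor ps = t" "pi_cost ps < pi_norm t + e"
proof -
  have "(INF ps\<in>{ps. abs_tensor ps = t}. pi_cost ps) < pi_norm t + e"
    using assms by (simp add: pi_norm_def)
  then show thesis
    using that ex_abs_tensor[of t]
    by (subst (asm) cINF_less_iff) (auto intro!: bdd_belowI2 pi_cost_nonneg)
qed

lemma pi_norm_zero [simp]: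
  "pi_norm (0 :: ('a::real_normed_vector, 'b::real_normed_vector) tensor) = 0"
  using pi_norm_le[of "[] :: ('a \<times> 'b) list"] pi_norm_nonneg[of "0 :: ('a, 'b) tensor"]
  by (simp add: zero_tensor_def)

lemma pi_norm_triangle: "pi_norm (s + t) \<le> pi_norm s + pi_norm t"
proof (rule field_le_epsilon)
  fix e :: real assume "e > 0"
  obtain ps where ps: "abs_tensor ps = s" "pi_cost ps < pi_norm s + e / 2"
    using pi_norm_approx[of "e / 2" s] \<open>e > 0\<close> by auto
  obtain qs where qs: "abs_tensor qs = t" "pi_cost qs < pi_norm t + e / 2"
    using pi_norm_approx[of "e / 2" t] \<open>e > 0\<close> by auto
  show "pi_norm (s + t) \<le> pi_norm s + pi_norm t + e"
    using pi_norm_le[of "ps @ qs"] ps qs by (auto simp: plus_tensor.abs_eq[symmetric])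
qed

lemma pi_norm_scaleR_le: "pi_norm (c *\<^sub>R t) \<le> \<bar>c\<bar> * pi_norm t"
proof (rule field_le_epsilon)
  fix e :: real assume e: "e > 0"
  then have "e / (\<bar>c\<bar> + 1) > 0" by (simp add: add_nonneg_pos)
  then obtain ps where ps: "abs_tensor ps = t" "pi_cost ps < pi_norm t + e / (\<bar>c\<bar> + 1)"
    by (rule pi_norm_approx)
  have "pi_norm (c *\<^sub>R t) \<le> \<bar>c\<bar> * pi_cost ps"
    using pi_norm_le[of "scale_left c ps"] ps(1) by (auto simp: scaleR_tensor.abs_eq[symmetric])
  also have "\<dots> \<le> \<bar>c\<bar> * (pi_norm t + e / (\<bar>c\<bar> + 1))"
    using ps(2) by (intro mult_left_mono) auto
  also have "\<dots> \<le> \<bar>c\<bar> * pi_norm t + e"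
    using e by (simp add: field_simps add_nonneg_pos)
  finally show "pi_norm (c *\<^sub>R t) \<le> \<bar>c\<bar> * pi_norm t + e" .
qed

lemma pi_norm_scaleR: "pi_norm (c *\<^sub>R t) = \<bar>c\<bar> * pi_norm t"
proof (cases "c = 0")
  case False
  have "pi_norm (inverse c *\<^sub>R c *\<^sub>R t) \<le> \<bar>inverse c\<bar> * pi_norm (c *\<^sub>R t)"
    by (rule pi_norm_scaleR_le)
  then show ?thesis
    using False pi_norm_scaleR_le[of c t] by (simp add: field_simps)
qed simp

lemma pi_norm_minus [simp]: "pi_norm (- t) = pi_norm t"
  using pi_norm_scaleR[of "-1" t] by simp

lemma pi_norm_minus_commute: "pi_norm (s - t) = pi_norm (t - s)"
  using pi_norm_minus[of "s - t"] by simp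

lemma pi_norm_triangle_diff: "pi_norm (s - u) \<le> pi_norm (s - t) + pi_norm (t - u)"
  using pi_norm_triangle[of "s - t" "t - u"] by simp

lemma pi_norm_diff_abs: "\<bar>pi_norm s - pi_norm t\<bar> \<le> pi_norm (s - t)"
  using pi_norm_triangle[of "s - t" t] pi_norm_triangle[of "t - s" s]
    pi_norm_minus_commute[of s t] by simp

section \<open>The completed projective tensor product\<close>

text \<open>Cauchy sequences of algebraic tensors modulo null sequences. The quotient only uses
  that \<^const>\<open>pi_norm\<close> is a seminorm; on the algebraic tensor product it is in fact a norm.\<close>

definition pi_Cauchy ::
    "(nat \<Rightarrow> ('a::real_normed_vector, 'b::real_normed_vector) tensor) \<Rightarrow> bool"
  where "pi_Cauchy s \<longleftrightarrow> (\<forall>e>0. \<exists>M. \<forall>m\<ge>M. \<forall>n\<ge>M. pi_norm (s m - s n) < e)"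

definition pi_equiv ::
    "(nat \<Rightarrow> ('a::real_normed_vector, 'b::real_normed_vector) tensor)
      \<Rightarrow> (nat \<Rightarrow> ('a, 'b) tensor) \<Rightarrow> bool"
  where "pi_equiv s t \<longleftrightarrow>
    pi_Cauchy s \<and> pi_Cauchy t \<and> (\<lambda>n. pi_norm (s n - t n)) \<longlonglongrightarrow> 0"

lemma pi_Cauchy_const [simp]: "pi_Cauchy (\<lambda>n. t)"
  by (simp add: pi_Cauchy_def)

lemma pi_Cauchy_add:
  assumes "pi_Cauchy s" "pi_Cauchy t" shows "pi_Cauchy (\<lambda>n. s n + t n)"
  unfolding pi_Cauchy_def
proof (intro allI impI)
  fix e :: real assume "e > 0"
  then obtain M N where M: "\<forall>m\<ge>M. \<forall>n\<ge>M. pi_norm (s m - s n) < e / 2"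
    and N: "\<forall>m\<ge>N. \<forall>n\<ge>N. pi_norm (t m - t n) < e / 2"
    using assms unfolding pi_Cauchy_def by (meson half_gt_zero)
  show "\<exists>M. \<forall>m\<ge>M. \<forall>n\<ge>M. pi_norm (s m + t m - (s n + t n)) < e"
  proof (intro exI[of _ "max M N"] allI impI)
    fix m n assume "max M N \<le> m" "max M N \<le> n"
    then have "pi_norm (s m - s n) < e / 2" "pi_norm (t m - t n) < e / 2"
      using M N by auto
    then show "pi_norm (s m + t m - (s n + t n)) < e"
      using pi_norm_triangle[of "s m - s n" "t m - t n"] by (simp add: algebra_simps)
  qed
qed

lemma pi_Cauchy_scaleR:
  assumes "pi_Cauchy s" shows "pi_Cauchy (\<lambda>n. c *\<^sub>R s n)"
  unfolding pi_Cauchy_def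
proof (intro allI impI)
  fix e :: real assume e: "e > 0"
  have "e / (\<bar>c\<bar> + 1) > 0" using e by (simp add: add_nonneg_pos)
  then obtain M where M: "\<forall>m\<ge>M. \<forall>n\<ge>M. pi_norm (s m - s n) < e / (\<bar>c\<bar> + 1)"
    using assms unfolding pi_Cauchy_def by blast
  show "\<exists>M. \<forall>m\<ge>M. \<forall>n\<ge>M. pi_norm (c *\<^sub>R s m - c *\<^sub>R s n) < e"
  proof (intro exI[of _ M] allI impI)
    fix m n assume "M \<le> m" "M \<le> n"
    then have "pi_norm (s m - s n) < e / (\<bar>c\<bar> + 1)" using M by blast
    then have "(\<bar>c\<bar> + 1) * pi_norm (s m - s n) < e"
      by (simp add: field_simps add_nonneg_pos)
    then show "pi_norm (c *\<^sub>R s m - c *\<^sub>R s n) < e"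
      using pi_norm_nonneg[of "s m - s n"]
      by (simp add: scaleR_diff_right[symmetric] pi_norm_scaleR distrib_right)
  qed
qed

lemma pi_Cauchy_convergent_norm:
  assumes "pi_Cauchy s" shows "convergent (\<lambda>n. pi_norm (s n))"
proof -
  have "Cauchy (\<lambda>n. pi_norm (s n))"
    unfolding Cauchy_def dist_real_def
    using assms pi_norm_diff_abs unfolding pi_Cauchy_def by (meson le_less_trans)
  then show ?thesis by (simp add: Cauchy_convergent_iff)
qed

lemma pi_equiv_refl [simp]: "pi_equiv s s \<longleftrightarrow> pi_Cauchy s"
  by (simp add: pi_equiv_def)

lemma pi_equiv_lim:
  assumes "pi_equiv s t" shows "lim (\<lambda>n. pi_norm (s n)) = lim (\<lambda>n. pi_norm (t n))"
proof -
  have "(\<lambda>n. pi_norm (s n)) \<longlonglongrightarrow> lim (\<lambda>n. pi_norm (s n))"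
    using assms pi_Cauchy_convergent_norm by (auto simp: pi_equiv_def convergent_LIMSEQ_iff)
  moreover have "(\<lambda>n. pi_norm (s n) - pi_norm (t n)) \<longlonglongrightarrow> 0"
    by (rule Lim_null_comparison[of _ "\<lambda>n. pi_norm (s n - t n)"])
      (use assms in \<open>auto simp: pi_equiv_def pi_norm_diff_abs\<close>)
  ultimately have "(\<lambda>n. pi_norm (s n) - (pi_norm (s n) - pi_norm (t n)))
      \<longlonglongrightarrow> lim (\<lambda>n. pi_norm (s n)) - 0"
    by (rule tendsto_diff)
  then show ?thesis by (simp add: limI)
qed

quotient_type (overloaded) ('a, 'b) ptensor =
    "nat \<Rightarrow> ('a::real_normed_vector, 'b::real_normed_vector) tensor" / partial: pi_equiv
proof (rule part_equivpI)
  show "\<exists>s::nat \<Rightarrow> ('a, 'b) tensor. pi_equiv s s"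
    by (rule exI[of _ "\<lambda>n. 0"]) simp
  show "symp (pi_equiv :: (nat \<Rightarrow> ('a, 'b) tensor) \<Rightarrow> _)"
    by (auto simp: symp_def pi_equiv_def pi_norm_minus_commute)
  show "transp (pi_equiv :: (nat \<Rightarrow> ('a, 'b) tensor) \<Rightarrow> _)"
  proof (rule transpI)
    fix s t u :: "nat \<Rightarrow> ('a, 'b) tensor"
    assume st: "pi_equiv s t" and tu: "pi_equiv t u"
    have "(\<lambda>n. pi_norm (s n - t n) + pi_norm (t n - u n)) \<longlonglongrightarrow> 0 + 0"
      using st tu by (intro tendsto_add) (auto simp: pi_equiv_def)
    then have "(\<lambda>n. pi_norm (s n - u n)) \<longlonglongrightarrow> 0"
      by (intro Lim_null_comparison[of "\<lambda>n. pi_norm (s n - u n)"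
            "\<lambda>n. pi_norm (s n - t n) + pi_norm (t n - u n)"])
        (auto simp: pi_norm_nonneg pi_norm_triangle_diff)
    then show "pi_equiv s u" using st tu by (simp add: pi_equiv_def)
  qed
qed

lemma pi_equiv_add:
  assumes "pi_equiv s s'" "pi_equiv t t'"
  shows "pi_equiv (\<lambda>n. s n + t n) (\<lambda>n. s' n + t' n)"
proof -
  have "(\<lambda>n. pi_norm (s n - s' n) + pi_norm (t n - t' n)) \<longlonglongrightarrow> 0 + 0"
    using assms by (intro tendsto_add) (auto simp: pi_equiv_def)
  moreover have "pi_norm (s n + t n - (s' n + t' n)) \<le> pi_norm (s n - s' n) + pi_norm (t n - t' n)"
    for n using pi_norm_triangle[of "s n - s' n" "t n - t' n"] by (simp add: algebra_simps)
  ultimately have "(\<lambda>n. pi_norm (s n + t n - (s' n + t' n))) \<longlonglongrightarrow> 0"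
    by (intro Lim_null_comparison[of "\<lambda>n. pi_norm (s n + t n - (s' n + t' n))"
          "\<lambda>n. pi_norm (s n - s' n) + pi_norm (t n - t' n)"])
      (auto simp: pi_norm_nonneg)
  then show ?thesis using assms by (simp add: pi_equiv_def pi_Cauchy_add)
qed

lemma pi_equiv_scaleR:
  assumes "pi_equiv s t" shows "pi_equiv (\<lambda>n. c *\<^sub>R s n) (\<lambda>n. c *\<^sub>R t n)"
proof -
  have "(\<lambda>n. \<bar>c\<bar> * pi_norm (s n - t n)) \<longlonglongrightarrow> \<bar>c\<bar> * 0"
    using assms by (intro tendsto_mult) (auto simp: pi_equiv_def)
  then show ?thesis
    using assms
    by (simp add: pi_equiv_def pi_Cauchy_scaleR scaleR_diff_right[symmetric] pi_norm_scaleR)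
qed

instantiation ptensor :: (real_normed_vector, real_normed_vector) real_vector
begin

lift_definition zero_ptensor :: "('a, 'b) ptensor" is "\<lambda>n. 0" by simp

lift_definition plus_ptensor :: "('a, 'b) ptensor \<Rightarrow> ('a, 'b) ptensor \<Rightarrow> ('a, 'b) ptensor"
  is "\<lambda>s t n. s n + t n" by (rule pi_equiv_add)

lift_definition scaleR_ptensor :: "real \<Rightarrow> ('a, 'b) ptensor \<Rightarrow> ('a, 'b) ptensor"
  is "\<lambda>c s n. c *\<^sub>R s n" by (rule pi_equiv_scaleR)

definition uminus_ptensor :: "('a, 'b) ptensor \<Rightarrow> ('a, 'b) ptensor"
  where "uminus_ptensor s = (-1) *\<^sub>R s"

definition minus_ptensor :: "('a, 'b) ptensor \<Rightarrow> ('a, 'b) ptensor \<Rightarrow> ('a, 'b) ptensor"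
  where "minus_ptensor s t = s + (- t)"

instance
proof
  fix s t u :: "('a, 'b) ptensor" and a b :: real
  show "s + t + u = s + (t + u)" "s + t = t + s" "0 + s = s"
    "a *\<^sub>R (s + t) = a *\<^sub>R s + a *\<^sub>R t" "(a + b) *\<^sub>R s = a *\<^sub>R s + b *\<^sub>R s"
    "a *\<^sub>R b *\<^sub>R s = (a * b) *\<^sub>R s" "1 *\<^sub>R s = s"
    by (transfer; simp add: pi_Cauchy_add pi_Cauchy_scaleR algebra_simps)+
  show "- s + s = 0"
    unfolding uminus_ptensor_def by transfer simp
  show "s - t = s + - t"
    by (simp add: minus_ptensor_def)
qed

end

instantiation ptensor :: (real_normed_vector, real_normed_vector) real_normed_vector
begin

lift_definition norm_ptensor :: "('a, 'b) ptensor \<Rightarrow> real"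
  is "\<lambda>s. lim (\<lambda>n. pi_norm (s n))" by (rule pi_equiv_lim)

definition dist_ptensor :: "('a, 'b) ptensor \<Rightarrow> ('a, 'b) ptensor \<Rightarrow> real"
  where "dist_ptensor s t = norm (s - t)"

definition sgn_ptensor :: "('a, 'b) ptensor \<Rightarrow> ('a, 'b) ptensor"
  where "sgn_ptensor s = s /\<^sub>R norm s"

definition uniformity_ptensor :: "(('a, 'b) ptensor \<times> ('a, 'b) ptensor) filter"
  where "uniformity_ptensor = (INF e\<in>{0 <..}. principal {(x, y). dist x y < e})"

definition open_ptensor :: "('a, 'b) ptensor set \<Rightarrow> bool"
  where "open_ptensor S = (\<forall>x\<in>S. \<forall>\<^sub>F (x', y) in uniformity. x' = x \<longrightarrow> y \<in> S)"

instance
proof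
  fix s t :: "('a, 'b) ptensor" and c :: real and S :: "('a, 'b) ptensor set"
  show "dist s t = norm (s - t)" by (rule dist_ptensor_def)
  show "sgn s = s /\<^sub>R norm s" by (rule sgn_ptensor_def)
  show "(uniformity :: (('a, 'b) ptensor \<times> _) filter) = (INF e\<in>{0 <..}. principal {(x, y). dist x y < e})"
    by (rule uniformity_ptensor_def)
  show "open S = (\<forall>x\<in>S. \<forall>\<^sub>F (x', y) in uniformity. x' = x \<longrightarrow> y \<in> S)"
    by (rule open_ptensor_def)
  show "norm s = 0 \<longleftrightarrow> s = 0"
  proof (transfer, rule iffI)
    fix s :: "nat \<Rightarrow> ('a, 'b) tensor"
    assume s: "pi_equiv s s" and "lim (\<lambda>n. pi_norm (s n)) = 0"
    then have "(\<lambda>n. pi_norm (s n)) \<longlonglongrightarrow> 0"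
      using pi_Cauchy_convergent_norm[of s] by (simp add: convergent_LIMSEQ_iff)
    with s show "pi_equiv s (\<lambda>n. 0)"
      by (simp add: pi_equiv_def)
  next
    fix s :: "nat \<Rightarrow> ('a, 'b) tensor"
    assume "pi_equiv s (\<lambda>n. 0)"
    then show "lim (\<lambda>n. pi_norm (s n)) = 0"
      using pi_equiv_lim by fastforce
  qed
  show "norm (s + t) \<le> norm s + norm t"
  proof transfer
    fix s t :: "nat \<Rightarrow> ('a, 'b) tensor"
    assume "pi_equiv s s" "pi_equiv t t"
    then have C: "pi_Cauchy s" "pi_Cauchy t" by simp_all
    show "lim (\<lambda>n. pi_norm (s n + t n)) \<le> lim (\<lambda>n. pi_norm (s n)) + lim (\<lambda>n. pi_norm (t n))"
      using C pi_Cauchy_convergent_norm[OF pi_Cauchy_add[OF C]]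
        pi_Cauchy_convergent_norm[OF C(1)] pi_Cauchy_convergent_norm[OF C(2)]
      by (intro LIMSEQ_le[of "\<lambda>n. pi_norm (s n + t n)" _ "\<lambda>n. pi_norm (s n) + pi_norm (t n)"]
          tendsto_add) (auto simp: convergent_LIMSEQ_iff pi_norm_triangle)
  qed
  show "norm (c *\<^sub>R s) = \<bar>c\<bar> * norm s"
  proof transfer
    fix c :: real and s :: "nat \<Rightarrow> ('a, 'b) tensor"
    assume "pi_equiv s s"
    then have "(\<lambda>n. pi_norm (s n)) \<longlonglongrightarrow> lim (\<lambda>n. pi_norm (s n))"
      using pi_Cauchy_convergent_norm by (auto simp: convergent_LIMSEQ_iff)
    then have "(\<lambda>n. \<bar>c\<bar> * pi_norm (s n)) \<longlonglongrightarrow> \<bar>c\<bar> * lim (\<lambda>n. pi_norm (s n))"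
      by (intro tendsto_mult) auto
    then show "lim (\<lambda>n. pi_norm (c *\<^sub>R s n)) = \<bar>c\<bar> * lim (\<lambda>n. pi_norm (s n))"
      by (simp add: pi_norm_scaleR limI)
  qed
qed

end

lift_definition of_tensor ::
    "('a::real_normed_vector, 'b::real_normed_vector) tensor \<Rightarrow> ('a, 'b) ptensor"
  is "\<lambda>t n. t" by simp

lemma of_tensor_add: "of_tensor (s + t) = of_tensor s + of_tensor t"
  by transfer simp

lemma of_tensor_scaleR: "of_tensor (c *\<^sub>R t) = c *\<^sub>R of_tensor t"
  by transfer simp

lemma of_tensor_diff: "of_tensor (s - t) = of_tensor s - of_tensor t"
  using of_tensor_add[of "s - t" t] by simp

lemma norm_of_tensor: "norm (of_tensor t) = pi_norm t"
  by transfer (simp add: limI)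

lemma of_tensor_tendsto:
  assumes "pi_Cauchy s" shows "(\<lambda>n. of_tensor (s n)) \<longlonglongrightarrow> abs_ptensor s"
proof (rule metric_LIMSEQ_I)
  fix e :: real assume "e > 0"
  then obtain M where M: "\<forall>m\<ge>M. \<forall>n\<ge>M. pi_norm (s m - s n) < e / 2"
    using assms unfolding pi_Cauchy_def by (meson half_gt_zero)
  have "dist (of_tensor (s n)) (abs_ptensor s) < e" if "n \<ge> M" for n
  proof -
    have C: "pi_Cauchy (\<lambda>k. s k + (-1) *\<^sub>R s n)"
      using assms by (intro pi_Cauchy_add) auto
    have "abs_ptensor s - of_tensor (s n) = abs_ptensor s + (-1) *\<^sub>R of_tensor (s n)"
      by simp
    also have "\<dots> = abs_ptensor (\<lambda>k. s k + (-1) *\<^sub>R s n)"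
      unfolding of_tensor.abs_eq of_tensor_def map_fun_def
      using assms by (simp add: scaleR_ptensor.abs_eq plus_ptensor.abs_eq del: scaleR_minus1_left scaleR_minus_left)
    finally have "norm (abs_ptensor s - of_tensor (s n)) = lim (\<lambda>k. pi_norm (s k - s n))"
      using C by (simp add: norm_ptensor.abs_eq)
    also have "\<dots> \<le> e / 2"
    proof (rule LIMSEQ_le_const2)
      show "(\<lambda>k. pi_norm (s k - s n)) \<longlonglongrightarrow> lim (\<lambda>k. pi_norm (s k - s n))"
        using pi_Cauchy_convergent_norm[OF C] by (simp add: convergent_LIMSEQ_iff)
      show "\<exists>N. \<forall>k\<ge>N. pi_norm (s k - s n) \<le> e / 2"
        using M that by (meson less_imp_le)
    qed
    finally show ?thesis using \<open>e > 0\<close> by (simp add: dist_norm norm_minus_commute)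
  qed
  then show "\<exists>M. \<forall>n\<ge>M. dist (of_tensor (s n)) (abs_ptensor s) < e" by blast
qed

lemma of_tensor_dense:
  assumes "e > 0" shows "\<exists>t. dist (of_tensor t) x < e"
proof -
  obtain s where "pi_Cauchy s" "x = abs_ptensor s"
    by (metis Quotient3_abs_rep Quotient3_ptensor Quotient3_rep_reflp pi_equiv_refl)
  then have "(\<lambda>n. of_tensor (s n)) \<longlonglongrightarrow> x" using of_tensor_tendsto by blast
  then show ?thesis using assms unfolding lim_sequentially by blast
qed

instance ptensor :: (real_normed_vector, real_normed_vector) banach
proof
  fix X :: "nat \<Rightarrow> ('a, 'b) ptensor" assume X: "Cauchy X"
  have "\<exists>t. \<forall>n. dist (of_tensor (t n)) (X n) < inverse (real (Suc n))"
    by (rule choice) (simp add: of_tensor_dense del: of_nat_Suc)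
  then obtain t where t: "\<And>n. dist (of_tensor (t n)) (X n) < inverse (real (Suc n))" by blast
  have diff: "(\<lambda>n. of_tensor (t n) - X n) \<longlonglongrightarrow> 0"
    by (rule Lim_null_comparison[OF _ LIMSEQ_inverse_real_of_nat])
      (use t in \<open>auto simp: dist_norm intro!: always_eventually less_imp_le\<close>)
  have "pi_Cauchy t"
    unfolding pi_Cauchy_def
  proof (intro allI impI)
    fix e :: real assume "e > 0"
    then have e: "e / 3 > 0" by simp
    obtain M where M: "\<And>m n. m \<ge> M \<Longrightarrow> n \<ge> M \<Longrightarrow> norm (X m - X n) < e / 3"
      using X e unfolding Cauchy_def dist_norm by meson
    obtain N where N: "\<And>n. n \<ge> N \<Longrightarrow> norm (of_tensor (t n) - X n) < e / 3"
      using LIMSEQ_D[OF diff e] by auto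
    show "\<exists>M. \<forall>m\<ge>M. \<forall>n\<ge>M. pi_norm (t m - t n) < e"
    proof (intro exI[of _ "max M N"] allI impI)
      fix m n assume mn: "max M N \<le> m" "max M N \<le> n"
      let ?a = "of_tensor (t m) - X m" and ?b = "of_tensor (t n) - X n"
      have "of_tensor (t m - t n) = (?a - ?b) + (X m - X n)"
        by (simp add: of_tensor_diff)
      then have "pi_norm (t m - t n) \<le> norm (?a - ?b) + norm (X m - X n)"
        by (metis norm_of_tensor norm_triangle_ineq)
      also have "norm (?a - ?b) \<le> norm ?a + norm ?b"
        by (rule norm_triangle_ineq4)
      finally show "pi_norm (t m - t n) < e"
        using M[of m n] N[of m] N[of n] mn by simp
    qed
  qed
  then have "(\<lambda>n. of_tensor (t n) - (of_tensor (t n) - X n)) \<longlonglongrightarrow> abs_ptensor t - 0"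
    using diff of_tensor_tendsto by (intro tendsto_diff)
  then show "convergent X" by (auto simp: convergent_def)
qed

definition ptimes :: "'a::real_normed_vector \<Rightarrow> 'b::real_normed_vector \<Rightarrow> ('a, 'b) ptensor"
    (infixr "\<otimes>\<^sub>\<pi>" 70)
  where "x \<otimes>\<^sub>\<pi> y = of_tensor (abs_tensor [(x, y)])"

lemma bounded_bilinear_ptimes: "bounded_bilinear (\<otimes>\<^sub>\<pi>)"
proof
  fix x x' :: 'a and y y' :: 'b and c :: real
  show "(x + x') \<otimes>\<^sub>\<pi> y = x \<otimes>\<^sub>\<pi> y + x' \<otimes>\<^sub>\<pi> y" "x \<otimes>\<^sub>\<pi> (y + y') = x \<otimes>\<^sub>\<pi> y + x \<otimes>\<^sub>\<pi> y'"
    unfolding ptimes_def of_tensor_add[symmetric] plus_tensor.abs_eq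
    by (auto intro!: arg_cong[of _ _ of_tensor]
        simp: tensor.abs_eq_iff tensor_eq_def bilinear_ladd bilinear_radd)
  show "(c *\<^sub>R x) \<otimes>\<^sub>\<pi> y = c *\<^sub>R (x \<otimes>\<^sub>\<pi> y)" "x \<otimes>\<^sub>\<pi> (c *\<^sub>R y) = c *\<^sub>R (x \<otimes>\<^sub>\<pi> y)"
    unfolding ptimes_def of_tensor_scaleR[symmetric] scaleR_tensor.abs_eq
    by (auto intro!: arg_cong[of _ _ of_tensor]
        simp: tensor.abs_eq_iff tensor_eq_def bilinear_lmul bilinear_rmul)
  have "norm (x \<otimes>\<^sub>\<pi> y) \<le> norm x * norm y * 1" for x :: 'a and y :: 'b
    using pi_norm_le[of "[(x, y)]"] by (simp add: ptimes_def norm_of_tensor)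
  then show "\<exists>K. \<forall>(x::'a) (y::'b). norm (x \<otimes>\<^sub>\<pi> y) \<le> norm x * norm y * K" by blast
qed

section \<open>The symmetric projective tensor product\<close>

definition sym_tensors :: "('a::real_normed_vector, 'a) ptensor set"
  where "sym_tensors = closure (span (range (\<lambda>u. u \<otimes>\<^sub>\<pi> u)))"

lemma subspace_sym_tensors: "subspace sym_tensors"
proof (rule subspaceI)
  let ?S = "span (range (\<lambda>u::'a. u \<otimes>\<^sub>\<pi> u))"
  show "0 \<in> (sym_tensors :: ('a, 'a) ptensor set)"
    using closure_subset[of ?S] span_zero by (auto simp: sym_tensors_def)
  fix s t :: "('a, 'a) ptensor" and c :: real
  assume "s \<in> sym_tensors"
  then obtain f where f: "\<And>n. f n \<in> ?S" "f \<longlonglongrightarrow> s"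
    unfolding sym_tensors_def closure_sequential by blast
  show "c *\<^sub>R s \<in> sym_tensors"
    unfolding sym_tensors_def closure_sequential
    using f span_scale by (intro exI[of _ "\<lambda>n. c *\<^sub>R f n"]) (auto intro!: tendsto_intros)
  assume "t \<in> sym_tensors"
  then obtain g where g: "\<And>n. g n \<in> ?S" "g \<longlonglongrightarrow> t"
    unfolding sym_tensors_def closure_sequential by blast
  show "s + t \<in> sym_tensors"
    unfolding sym_tensors_def closure_sequential
    using f g by (intro exI[of _ "\<lambda>n. f n + g n"]) (auto intro!: tendsto_intros span_add)
qed

lemma closed_sym_tensors: "closed sym_tensors"
  by (simp add: sym_tensors_def)

typedef (overloaded) 'a sym_ptensor =
    "sym_tensors :: ('a::real_normed_vector, 'a) ptensor set"
  using subspace_0[OF subspace_sym_tensors] by blast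

setup_lifting type_definition_sym_ptensor

instantiation sym_ptensor :: (real_normed_vector) real_vector
begin

lift_definition zero_sym_ptensor :: "'a sym_ptensor" is 0
  by (rule subspace_0[OF subspace_sym_tensors])

lift_definition plus_sym_ptensor :: "'a sym_ptensor \<Rightarrow> 'a sym_ptensor \<Rightarrow> 'a sym_ptensor"
  is "(+)" by (rule subspace_add[OF subspace_sym_tensors])

lift_definition minus_sym_ptensor :: "'a sym_ptensor \<Rightarrow> 'a sym_ptensor \<Rightarrow> 'a sym_ptensor"
  is "(-)" by (rule subspace_diff[OF subspace_sym_tensors])

lift_definition uminus_sym_ptensor :: "'a sym_ptensor \<Rightarrow> 'a sym_ptensor"
  is uminus by (rule subspace_neg[OF subspace_sym_tensors])

lift_definition scaleR_sym_ptensor :: "real \<Rightarrow> 'a sym_ptensor \<Rightarrow> 'a sym_ptensor"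
  is scaleR by (rule subspace_scale[OF subspace_sym_tensors])

instance
proof
  fix s t u :: "'a sym_ptensor" and a b :: real
  show "s + t + u = s + (t + u)" "s + t = t + s" "0 + s = s" "- s + s = 0" "s - t = s + - t"
    by (transfer, simp add: add.assoc add.commute)+
  show "a *\<^sub>R (s + t) = a *\<^sub>R s + a *\<^sub>R t" "(a + b) *\<^sub>R s = a *\<^sub>R s + b *\<^sub>R s"
    "a *\<^sub>R b *\<^sub>R s = (a * b) *\<^sub>R s" "1 *\<^sub>R s = s"
    by (transfer; simp add: scaleR_add_right scaleR_add_left)+
qed

end

instantiation sym_ptensor :: (real_normed_vector) real_normed_vector
begin

lift_definition norm_sym_ptensor :: "'a sym_ptensor \<Rightarrow> real" is norm .

definition dist_sym_ptensor :: "'a sym_ptensor \<Rightarrow> 'a sym_ptensor \<Rightarrow> real"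
  where "dist_sym_ptensor s t = norm (s - t)"

definition sgn_sym_ptensor :: "'a sym_ptensor \<Rightarrow> 'a sym_ptensor"
  where "sgn_sym_ptensor s = s /\<^sub>R norm s"

definition uniformity_sym_ptensor :: "('a sym_ptensor \<times> 'a sym_ptensor) filter"
  where "uniformity_sym_ptensor = (INF e\<in>{0 <..}. principal {(x, y). dist x y < e})"

definition open_sym_ptensor :: "'a sym_ptensor set \<Rightarrow> bool"
  where "open_sym_ptensor S = (\<forall>x\<in>S. \<forall>\<^sub>F (x', y) in uniformity. x' = x \<longrightarrow> y \<in> S)"

instance
proof
  fix s t :: "'a sym_ptensor" and a :: real and S :: "'a sym_ptensor set"
  show "norm s = 0 \<longleftrightarrow> s = 0" "norm (a *\<^sub>R s) = \<bar>a\<bar> * norm s"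
    by (transfer; simp)+
  show "norm (s + t) \<le> norm s + norm t"
    by transfer (rule norm_triangle_ineq)
  show "dist s t = norm (s - t)" by (rule dist_sym_ptensor_def)
  show "sgn s = s /\<^sub>R norm s" by (rule sgn_sym_ptensor_def)
  show "(uniformity :: ('a sym_ptensor \<times> _) filter) = (INF e\<in>{0 <..}. principal {(x, y). dist x y < e})"
    by (rule uniformity_sym_ptensor_def)
  show "open S = (\<forall>x\<in>S. \<forall>\<^sub>F (x', y) in uniformity. x' = x \<longrightarrow> y \<in> S)"
    by (rule open_sym_ptensor_def)
qed

end

lemma dist_Rep_sym_ptensor: "dist (Rep_sym_ptensor s) (Rep_sym_ptensor t) = dist s t"
  by (simp add: dist_norm norm_sym_ptensor.rep_eq minus_sym_ptensor.rep_eq)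

instance sym_ptensor :: (real_normed_vector) banach
proof
  fix X :: "nat \<Rightarrow> 'a sym_ptensor" assume "Cauchy X"
  then have "Cauchy (\<lambda>n. Rep_sym_ptensor (X n))"
    by (simp add: Cauchy_def dist_Rep_sym_ptensor)
  then obtain l where l: "(\<lambda>n. Rep_sym_ptensor (X n)) \<longlonglongrightarrow> l"
    by (auto simp: Cauchy_convergent_iff convergent_def)
  have "l \<in> sym_tensors"
    by (rule closed_sequentially[OF closed_sym_tensors _ l]) (rule Rep_sym_ptensor)
  then obtain x where "l = Rep_sym_ptensor x" by (metis Abs_sym_ptensor_inverse)
  with l have "X \<longlonglongrightarrow> x" by (simp add: lim_sequentially dist_Rep_sym_ptensor)
  then show "convergent X" by (auto simp: convergent_def)
qed

lift_definition tensor_square :: "'a::real_normed_vector \<Rightarrow> 'a sym_ptensor"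
  is "\<lambda>u. u \<otimes>\<^sub>\<pi> u"
  unfolding sym_tensors_def by (meson closure_subset range_eqI span_base subset_iff)

section \<open>Dilinear mappings\<close>

definition is_bounded_lifting ::
    "('a::real_normed_vector \<Rightarrow> 'b::real_normed_vector) \<Rightarrow> (('a \<times> 'a sym_ptensor) \<Rightarrow>\<^sub>L 'b) \<Rightarrow> bool"
  where "is_bounded_lifting K L \<longleftrightarrow> (\<forall>u. K u = blinfun_apply L (u, tensor_square u))"

definition bounded_dilinear :: "('a::real_normed_vector \<Rightarrow> 'b::real_normed_vector) \<Rightarrow> bool"
  where "bounded_dilinear K \<longleftrightarrow> (\<exists>L. is_bounded_lifting K L)"

definition lifting ::
    "('a::real_normed_vector \<Rightarrow> 'b::real_normed_vector) \<Rightarrow> (('a \<times> 'a sym_ptensor) \<Rightarrow>\<^sub>L 'b)"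
  where "lifting K = (THE L. is_bounded_lifting K L)"

lemma tensor_square_scaleR: "tensor_square (c *\<^sub>R u) = (c * c) *\<^sub>R tensor_square u"
proof transfer
  fix c :: real and u :: 'a
  interpret bounded_bilinear "(\<otimes>\<^sub>\<pi>) :: 'a \<Rightarrow> 'a \<Rightarrow> _" by (rule bounded_bilinear_ptimes)
  show "(c *\<^sub>R u) \<otimes>\<^sub>\<pi> (c *\<^sub>R u) = (c * c) *\<^sub>R (u \<otimes>\<^sub>\<pi> u)" by (simp add: scaleR_left scaleR_right)
qed

lemma closure_span_tensor_square: "closure (span (range tensor_square)) = UNIV"
proof (intro set_eqI iffI UNIV_I)
  fix x :: "'a sym_ptensor"
  have span: "\<exists>s\<in>span (range tensor_square). Rep_sym_ptensor s = z"
    if "z \<in> span (range (\<lambda>u::'a. u \<otimes>\<^sub>\<pi> u))" for z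
    using that
  proof (induction rule: span_induct_alt)
    case base
    show ?case by (rule bexI[of _ 0]) (auto simp: zero_sym_ptensor.rep_eq span_zero)
  next
    case (step c z y)
    then obtain u s where "z = u \<otimes>\<^sub>\<pi> u" "s \<in> span (range tensor_square)" "Rep_sym_ptensor s = y"
      by auto
    then show ?case
      by (intro bexI[of _ "c *\<^sub>R tensor_square u + s"])
        (auto simp: plus_sym_ptensor.rep_eq scaleR_sym_ptensor.rep_eq tensor_square.rep_eq
          intro!: span_add span_scale intro: span_base)
  qed
  show "x \<in> closure (span (range tensor_square))"
    unfolding closure_approachable
  proof (intro allI impI)
    fix e :: real assume "e > 0"
    have "Rep_sym_ptensor x \<in> closure (span (range (\<lambda>u::'a. u \<otimes>\<^sub>\<pi> u)))"
      using Rep_sym_ptensor[of x] by (simp add: sym_tensors_def)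
    then obtain z where "z \<in> span (range (\<lambda>u::'a. u \<otimes>\<^sub>\<pi> u))" "dist z (Rep_sym_ptensor x) < e"
      using \<open>e > 0\<close> unfolding closure_approachable by blast
    then show "\<exists>s\<in>span (range tensor_square). dist s x < e"
      using span by (metis dist_Rep_sym_ptensor)
  qed
qed

lemma bounded_lifting_unique:
  assumes L: "is_bounded_lifting K L" and M: "is_bounded_lifting K M" shows "L = M"
proof -
  define D where "D = L - M"
  have D0: "D (u, tensor_square u) = 0" for u
    using L M by (simp add: D_def is_bounded_lifting_def minus_blinfun.rep_eq)
  have Dsplit: "D (x, s) = D (x, 0) + D (0, s)" for x s
    by (simp add: blinfun.add_right[symmetric])
  have x0: "D (u, 0) = 0" and s0: "D (0, tensor_square u) = 0" for u
  proof -
    have a: "D (u, 0) + D (0, tensor_square u) = 0" using D0[of u] unfolding Dsplit[of u "tensor_square u"] .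
    have "(2 *\<^sub>R u, tensor_square (2 *\<^sub>R u)) = 2 *\<^sub>R (u, 0) + 4 *\<^sub>R (0, tensor_square u)"
      by (simp add: tensor_square_scaleR)
    then have "D (2 *\<^sub>R (u, 0) + 4 *\<^sub>R (0, tensor_square u)) = 0"
      using D0[of "2 *\<^sub>R u"] by metis
    then have b: "2 *\<^sub>R D (u, 0) + 4 *\<^sub>R D (0, tensor_square u) = 0"
      unfolding blinfun.add_right blinfun.scaleR_right .
    from a have p: "D (u, 0) = - D (0, tensor_square u)" by (rule eq_neg_iff_add_eq_0[THEN iffD2])
    have "(-2 + 4 :: real) *\<^sub>R D (0, tensor_square u) = 2 *\<^sub>R D (u, 0) + 4 *\<^sub>R D (0, tensor_square u)"
      unfolding scaleR_add_left by (simp add: p)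
    then show "D (0, tensor_square u) = 0" using b by simp
    with a show "D (u, 0) = 0" by simp
  qed
  let ?Z = "{s. D (0, s) = 0}"
  have "closed ?Z"
    by (intro closed_Collect_eq continuous_intros)
  moreover have "subspace ?Z"
  proof (rule subspaceI)
    show "0 \<in> ?Z" by (simp flip: zero_prod_def)
    show "s + t \<in> ?Z" if "s \<in> ?Z" "t \<in> ?Z" for s t
      using that blinfun.add_right[of D "(0, s)" "(0, t)"] by simp
    show "c *\<^sub>R s \<in> ?Z" if "s \<in> ?Z" for c s
      using that blinfun.scaleR_right[of D c "(0, s)"] by simp
  qed
  moreover have "range tensor_square \<subseteq> ?Z" using s0 by auto
  ultimately have "closure (span (range tensor_square)) \<subseteq> ?Z"
    by (meson closure_minimal span_minimal)
  then have "D (0, s) = 0" for s by (auto simp: closure_span_tensor_square)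
  then have "D p = 0" for p
    using Dsplit[of "fst p" "snd p"] x0 by simp
  then have "D = 0" by (auto intro: blinfun_eqI)
  then show ?thesis by (simp add: D_def)
qed

lemma is_bounded_lifting_lifting: "bounded_dilinear K \<Longrightarrow> is_bounded_lifting K (lifting K)"
  unfolding bounded_dilinear_def lifting_def
  by (rule theI') (auto intro: bounded_lifting_unique)

section \<open>Subdifferentials\<close>

text \<open>The dual of a product is identified with the product of the duals.\<close>

definition adjoint_pair ::
    "(('x::real_normed_vector \<times> 's::real_normed_vector) \<Rightarrow>\<^sub>L 'y::real_normed_vector) \<Rightarrow> ('y \<Rightarrow>\<^sub>L real)
      \<Rightarrow> ('x \<Rightarrow>\<^sub>L real) \<times> ('s \<Rightarrow>\<^sub>L real)"
  where "adjoint_pair L \<eta> =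
    (Blinfun (\<lambda>x. \<eta> (L (x, 0))), Blinfun (\<lambda>s. \<eta> (L (0, s))))"

lemma adjoint_pair_apply:
  "fst (adjoint_pair L \<eta>) x + snd (adjoint_pair L \<eta>) s = \<eta> (L (x, s))"
proof -
  have "bounded_linear (\<lambda>x. \<eta> (L (x, 0)))" "bounded_linear (\<lambda>s. \<eta> (L (0, s)))"
    by (intro bounded_linear_intros bounded_linear_Pair)+
  then show ?thesis
    by (simp add: adjoint_pair_def bounded_linear_Blinfun_apply blinfun.add_right[symmetric])
qed

text \<open>Since \<open>\<infinity> + (- \<infinity>) = \<infinity>\<close> in \<^typ>\<open>ereal\<close>, the inequality is void where one of the two
  values is \<open>\<infinity>\<close>; so this is convexity of the epigraph.\<close>

definition ereal_convex :: "('a::real_vector \<Rightarrow> ereal) \<Rightarrow> bool"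
  where "ereal_convex F \<longleftrightarrow> (\<forall>x y. \<forall>t::real. 0 < t \<and> t < 1 \<longrightarrow>
    F ((1 - t) *\<^sub>R x + t *\<^sub>R y) \<le> ereal (1 - t) * F x + ereal t * F y)"

definition subdifferential ::
    "('a::real_normed_vector \<Rightarrow> ereal) \<Rightarrow> 'a \<Rightarrow> ('a \<Rightarrow>\<^sub>L real) set"
  where "subdifferential F y =
    {\<xi>. \<bar>F y\<bar> \<noteq> \<infinity> \<and> (\<forall>v. F v \<ge> F y + ereal (blinfun_apply \<xi> (v - y)))}"

definition dilinear_subdifferential ::
    "('a::real_normed_vector \<Rightarrow> ereal) \<Rightarrow> 'a \<Rightarrow> (('a \<Rightarrow>\<^sub>L real) \<times> ('a sym_ptensor \<Rightarrow>\<^sub>L real)) set"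
  where "dilinear_subdifferential G u =
    {(\<xi>, \<Xi>). \<bar>G u\<bar> \<noteq> \<infinity> \<and>
      (\<forall>v. G v \<ge> G u + ereal (blinfun_apply \<xi> (v - u))
        + ereal (blinfun_apply \<Xi> (tensor_square v - tensor_square u)))}"

end

theory Submission
  imports Defs
begin

text \<open>Through its lifting \<open>L\<close>, \<open>K\<close> is linear in the pair
  \<open>(v, tensor_square v)\<close>, so \<open>K v - K u\<close> is \<open>L\<close> applied to
  the difference of two such pairs. A subgradient inequality for \<open>F\<close> at
  \<open>K u\<close>, tested only at points \<open>K v\<close>, becomes the dilinear one once
  \<open>L\<close> is moved across the pairing (\<open>adjoint_pair_apply\<close>).\<close>

theorem proposition3p12:
  fixes K :: "'x::banach \<Rightarrow> 'y::banach" and F :: "'y \<Rightarrow> ereal" and u :: 'x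
  assumes "bounded_dilinear K"
    and "ereal_convex F"
  shows "adjoint_pair (lifting K) ` subdifferential F (K u) \<subseteq> dilinear_subdifferential (F \<circ> K) u"
proof
  fix p assume "p \<in> adjoint_pair (lifting K) ` subdifferential F (K u)"
  then obtain \<eta> where p: "p = adjoint_pair (lifting K) \<eta>" and fin: "\<bar>F (K u)\<bar> \<noteq> \<infinity>"
    and sub: "\<And>y. F y \<ge> F (K u) + ereal (\<eta> (y - K u))"
    by (auto simp: subdifferential_def)
  have K: "K w = lifting K (w, tensor_square w)" for w
    using is_bounded_lifting_lifting[OF assms(1)] by (simp add: is_bounded_lifting_def)
  \<comment> \<open>The two components of \<open>p\<close> recombine into \<eta> after
    \<open>L\<close> at a single pair; that pair is a difference of lifted points, so linearity of
    \<open>L\<close> applies.\<close>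
  have "fst p (v - u) + snd p (tensor_square v - tensor_square u) = \<eta> (K v - K u)" for v
    unfolding p adjoint_pair_apply K[of v] K[of u] by (simp flip: blinfun.diff_right)
  then have "F (K u) + ereal (fst p (v - u)) + ereal (snd p (tensor_square v - tensor_square u))
      \<le> F (K v)" for v
    using sub[of "K v"] by (simp add: add.assoc)
  with fin show "p \<in> dilinear_subdifferential (F \<circ> K) u"
    by (simp add: dilinear_subdifferential_def case_prod_beta)
qed

end
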